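(* Let $m \ge 7$ and let $F \subseteq \mathcal{C}_m$ be a non-degenerate face of the Kunz cone. Let $e = \mathsf{e}(F)$ be the embedding dimension of $F$ and $d = \dim F$. (a) If $e = m-1$, then $d = m-1$. (b) If $e = m-2$, then $\lfloor \tfrac12(m-1)\rfloor \le d \le e$. (c) If $e = m-3$ and $m$ is odd, then $2 \le d \le e$.
   Context: Kunz cone. For an integer $m \ge 2$ write $\mathbb{Z}_m = \mathbb{Z}/m\mathbb{Z}$. The Kunz cone $\mathcal{C}_m \subseteq \mathbb{R}_{\ge 0}^{m-1}$, with coordinates indexed by $\mathbb{Z}_m \setminus \{0\}$, is the pointed rational polyhedral cone of all $x$ with $x_i + x_j \ge x_{i+j}$ for all $i,j \in \mathbb{Z}_m\setminus\{0\}$ with $i+j \ne 0$. Faces of $\mathcal{C}_m$ are its (nonempty) faces in the usual sense for polyhedral cones, i.e. intersections of facets, with $\mathcal{C}_m$ itself included; $\dim F = \dim_{\mathbb{R}} \operatorname{span}_{\mathbb{R}} F$. The interior $F^\circ$ of a face $F$ is the set of points of $F$ not lying in any face properly contained in $F$. A face $F$ is degenerate if some $x \in F^\circ$ has some coordinate $x_i = 0$, and non-degenerate otherwise. Kunz nilsemigroup. For a non-degenerate face $F \subseteq \mathcal{C}_m$, pick $x \in F^\circ$ and set $x_0 = 0$. The Kunz nilsemigroup of $F$ is $N = \mathbb{Z}_m \cup \{\infty\}$ with the commutative operation $\oplus$ for which $\infty$ is nil ($a \oplus \infty = \infty$ for all $a$) and, for $a,b \in \mathbb{Z}_m$, $a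 \oplus b = a+b$ if $x_a + x_b = x_{a+b}$ and $a \oplus b = \infty$ otherwise. It does not depend on the choice of $x \in F^\circ$. The atoms of $N$ are the elements that cannot be written as a sum of two non-identity elements. The embedding dimension $\mathsf{e}(F)$ is the number of atoms of $N$. *)

theory Defs
  imports
    "HOL-Analysis.Analysis"
    "HOL-Algebra.Group"
    "Berlekamp_Zassenhaus.Finite_Field"
begin

text \<open>
  Throughout, \<open>'m mod_ring\<close> is the ring of integers modulo \<open>m = CARD('m)\<close>; the class
  \<open>nontriv\<close> says exactly \<open>m \<ge> 2\<close>.  The space \<open>\<real>\<^sup>m\<^sup>-\<^sup>1\<close> with coordinates indexed by the nonzero
  residues is realised as the hyperplane \<open>x $ 0 = 0\<close> of \<open>\<real>\<^sup>m\<close>, so that the convention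
  \<open>x\<^sub>0 = 0\<close> used for the Kunz nilsemigroup holds automatically.  Faces and dimensions are
  intrinsic and hence unaffected by this embedding.
\<close>

definition kunz_cone :: "(real ^ ('m::nontriv) mod_ring) set" where
  "kunz_cone = {x. x $ 0 = 0 \<and> (\<forall>i. i \<noteq> 0 \<longrightarrow> 0 \<le> x $ i) \<and>
     (\<forall>i j. i \<noteq> 0 \<longrightarrow> j \<noteq> 0 \<longrightarrow> i + j \<noteq> 0 \<longrightarrow> x $ i + x $ j \<ge> x $ (i + j))}"

text \<open>
  Library faces may be empty, which is excluded here.  Lemma \<open>kunz_face_iff_Inter_facets\<close>
  below shows that these are the intersections of facets, the cone itself included.
\<close>

definition kunz_face :: "(real ^ ('m::nontriv) mod_ring) set \<Rightarrow> bool" where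
  "kunz_face F \<longleftrightarrow> F face_of kunz_cone \<and> F \<noteq> {}"

definition face_interior ::
    "(real ^ ('m::nontriv) mod_ring) set \<Rightarrow> (real ^ 'm mod_ring) set" where
  "face_interior F = {x \<in> F. \<forall>G. kunz_face G \<and> G \<subset> F \<longrightarrow> x \<notin> G}"

definition degenerate :: "(real ^ ('m::nontriv) mod_ring) set \<Rightarrow> bool" where
  "degenerate F \<longleftrightarrow> (\<exists>x \<in> face_interior F. \<exists>i. i \<noteq> 0 \<and> x $ i = 0)"

text \<open>The nil element \<open>\<infinity>\<close> is \<open>None\<close>, and a residue \<open>a\<close> is \<open>Some a\<close>.\<close>

fun nil_add ::
    "real ^ ('m::nontriv) mod_ring \<Rightarrow> 'm mod_ring option \<Rightarrow> 'm mod_ring option \<Rightarrow> 'm mod_ring option"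
where
  "nil_add x (Some a) (Some b) = (if x $ a + x $ b = x $ (a + b) then Some (a + b) else None)"
| "nil_add x _ _ = None"

definition kunz_nilsemigroup ::
    "(real ^ ('m::nontriv) mod_ring) set \<Rightarrow> 'm mod_ring option monoid" where
  "kunz_nilsemigroup F =
     \<lparr>carrier = UNIV, mult = nil_add (SOME x. x \<in> face_interior F), one = Some 0\<rparr>"

text \<open>As usual, the identity element does not count as an atom.\<close>

definition atoms :: "('a, 'b) monoid_scheme \<Rightarrow> 'a set" where
  "atoms N = {a \<in> carrier N - {\<one>\<^bsub>N\<^esub>}.
     \<not> (\<exists>b \<in> carrier N - {\<one>\<^bsub>N\<^esub>}. \<exists>c \<in> carrier N - {\<one>\<^bsub>N\<^esub>}. a = b \<otimes>\<^bsub>N\<^esub> c)}"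

definition embdim :: "(real ^ ('m::nontriv) mod_ring) set \<Rightarrow> nat" where
  "embdim F = card (atoms (kunz_nilsemigroup F))"

lemma polyhedron_kunz_cone: "polyhedron (kunz_cone :: (real ^ ('m::nontriv) mod_ring) set)"
proof -
  let ?ax = "\<lambda>i. axis i (1::real) :: real ^ 'm mod_ring"
  let ?A = "{x. ?ax 0 \<bullet> x \<le> 0}" and ?B = "{x. ?ax 0 \<bullet> x \<ge> 0}"
  let ?P = "(\<lambda>i. {x. ?ax i \<bullet> x \<ge> 0}) ` (UNIV - {0})"
  let ?Q = "(\<lambda>(i, j). {x. (?ax i + ?ax j - ?ax (i + j)) \<bullet> x \<ge> 0}) `
              {(i, j). i \<noteq> 0 \<and> j \<noteq> 0 \<and> i + j \<noteq> 0}"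
  have "kunz_cone = ?A \<inter> ?B \<inter> (\<Inter>?P \<inter> \<Inter>?Q)"
    by (auto simp: kunz_cone_def inner_axis' inner_add_left inner_diff_left)
  moreover have "polyhedron (\<Inter>?P)" "polyhedron (\<Inter>?Q)"
    by (auto intro!: polyhedron_Inter simp: polyhedron_halfspace_ge)
  then have "polyhedron (?A \<inter> ?B \<inter> (\<Inter>?P \<inter> \<Inter>?Q))"
    by (intro polyhedron_Int polyhedron_halfspace_ge polyhedron_halfspace_le)
  ultimately show ?thesis
    by (rule ssubst)
qed

lemma zero_in_kunz_face:
  fixes F :: "(real ^ ('m::nontriv) mod_ring) set"
  assumes "kunz_face F"
  shows "0 \<in> F"
proof -
  have F: "F face_of kunz_cone" and "F \<noteq> {}" using assms by (auto simp: kunz_face_def)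
  then obtain x where x: "x \<in> F" by blast
  have xC: "x \<in> kunz_cone" using F x face_of_imp_subset by blast
  have C: "0 \<in> (kunz_cone :: (real ^ 'm mod_ring) set)" "2 *\<^sub>R x \<in> kunz_cone"
    using xC by (auto simp: kunz_cone_def) (smt (verit))
  show ?thesis
  proof (cases "x = 0")
    case False
    have "x \<in> open_segment 0 (2 *\<^sub>R x)"
      using False by (auto simp: in_segment intro!: exI[of _ "1/2"])
    then show ?thesis using F C x by (auto simp: face_of_def)
  qed (use x in simp)
qed

lemma kunz_face_iff_Inter_facets:
  fixes F :: "(real ^ ('m::nontriv) mod_ring) set"
  shows "kunz_face F \<longleftrightarrow> (\<exists>H. (\<forall>G \<in> H. G facet_of kunz_cone) \<and> F = kunz_cone \<inter> \<Inter>H)"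
proof
  assume F: "kunz_face F"
  show "\<exists>H. (\<forall>G \<in> H. G facet_of kunz_cone) \<and> F = kunz_cone \<inter> \<Inter>H"
  proof (cases "F = kunz_cone")
    case True
    then show ?thesis by (intro exI[of _ "{}"]) auto
  next
    case False
    then have "F = \<Inter>{G. G facet_of kunz_cone \<and> F \<subseteq> G}"
      using F face_of_polyhedron[OF polyhedron_kunz_cone] by (auto simp: kunz_face_def)
    moreover have "F \<subseteq> kunz_cone" using F by (simp add: kunz_face_def face_of_imp_subset)
    ultimately show ?thesis
      by (intro exI[of _ "{G. G facet_of kunz_cone \<and> F \<subseteq> G}"]) auto
  qed
next
  assume "\<exists>H. (\<forall>G \<in> H. G facet_of kunz_cone) \<and> F = kunz_cone \<inter> \<Inter>H"
  then obtain H where H: "\<And>G. G \<in> H \<Longrightarrow> G facet_of kunz_cone" and F: "F = \<Inter>(insert kunz_cone H)"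
    by auto
  have G: "G face_of kunz_cone" if "G \<in> insert kunz_cone H" for G
    using that H by (auto simp: facet_of_def face_of_refl polyhedron_imp_convex polyhedron_kunz_cone)
  have "0 \<in> G" if "G \<in> insert kunz_cone H" for G
  proof -
    have "(0 :: real ^ 'm mod_ring) \<in> kunz_cone" by (simp add: kunz_cone_def)
    then have "G \<noteq> {}" using that H by (auto simp: facet_of_def)
    then show ?thesis using G[OF that] zero_in_kunz_face by (auto simp: kunz_face_def)
  qed
  then have "F \<noteq> {}" using F by blast
  moreover have "F face_of kunz_cone" unfolding F by (rule face_of_Inter) (use G in auto)
  ultimately show "kunz_face F" by (simp add: kunz_face_def)
qed

end

theory Submission
  imports Defs
begin

text \<open>
  Let \<open>x\<close> be an interior point of the face \<open>F\<close>. Non-degeneracy makes all its coordinates with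
  nonzero index positive, so the only defining inequalities that are tight at \<open>x\<close> are the
  relations \<open>x\<^sub>a + x\<^sub>b = x\<^bsub>a+b\<^esub>\<close>, and the linear span of \<open>F\<close> is the solution space
  of exactly these relations together with \<open>y\<^sub>0 = 0\<close>. Writing \<open>r\<close> for the rank of that
  linear system, \<open>dim F = m - r\<close> (\<open>dim_face\<close>). The residues \<open>c\<close> that arise as \<open>a + b\<close> in a
  tight relation are precisely the nonzero non-atoms, so there are \<open>m - 1 - e\<close> of them
  (\<open>embdim_conv_nonatoms\<close>). It remains to bound \<open>r\<close>.

  Lower bound on \<open>r\<close>. In a tight relation \<open>x\<^sub>a\<close> and \<open>x\<^sub>b\<close> are smaller than
  \<open>x\<^bsub>a+b\<^esub>\<close>. By induction on the size of \<open>x\<^sub>c\<close>, every coordinate is therefore a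
  combination of the atom coordinates modulo the system, whence \<open>d \<le> e\<close> in all cases
  (\<open>dim_tight_forms_ge\<close>).

  Upper bound on \<open>r\<close>. A residue \<open>c \<noteq> 0\<close> has at most \<open>\<lfloor>m/2\<rfloor>\<close> unordered decompositions
  \<open>c = a + b\<close> into nonzero residues (\<open>card_decomposition_forms\<close>). With no non-atom this gives
  \<open>r = 1\<close>, and with one non-atom \<open>r \<le> \<lfloor>m/2\<rfloor> + 1\<close>, which are (a) and (b).

  In (c) let the non-atoms be \<open>p, q\<close> with \<open>x\<^sub>p \<le> x\<^sub>q\<close>. The decomposition
  \<open>p = q + (p - q)\<close> cannot be tight, so for odd \<open>m\<close> at most \<open>m - 2\<close> relations are possible,
  one too many for the desired \<open>d \<ge> 2\<close>. But they cannot all hold: if they did, combining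
  \<open>x\<^sub>a + x\<^bsub>p-a\<^esub> = x\<^sub>p\<close> with \<open>x\<^bsub>p-a\<^esub> + x\<^bsub>a+q-p\<^esub> = x\<^sub>q\<close> and
  \<open>x\<^bsub>q-p\<^esub> = x\<^sub>q - x\<^sub>p\<close> would yield \<open>x\<^sub>a + x\<^bsub>q-p\<^esub> = x\<^bsub>a+q-p\<^esub>\<close>, making
  \<open>a + q - p\<close> a non-atom for all but a few \<open>a\<close>, although \<open>p\<close> and \<open>q\<close> are the only ones
  (\<open>not_all_tight\<close>).
\<close>

section \<open>Tight relations and the dimension of a face\<close>

definition kunz_form :: "'m::nontriv mod_ring \<Rightarrow> 'm mod_ring \<Rightarrow> real ^ 'm mod_ring" where
  "kunz_form a b = axis a 1 + axis b 1 - axis (a + b) 1"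

definition tight_forms :: "real ^ 'm::nontriv mod_ring \<Rightarrow> (real ^ 'm mod_ring) set" where
  "tight_forms x = {kunz_form a b | a b.
     a \<noteq> 0 \<and> b \<noteq> 0 \<and> a + b \<noteq> 0 \<and> x $ a + x $ b = x $ (a + b)}"

lemma inner_kunz_form: "kunz_form a b \<bullet> y = y $ a + y $ b - y $ (a + b)"
  by (simp add: kunz_form_def inner_axis' inner_add_left inner_diff_left)

lemma kunz_form_commute: "kunz_form a b = kunz_form b a"
  by (simp add: kunz_form_def add.commute)

lemma kunz_cone_inner_ge_0:
  assumes "y \<in> kunz_cone" "a \<noteq> 0" "b \<noteq> 0" "a + b \<noteq> 0"
  shows "kunz_form a b \<bullet> y \<ge> 0"
  using assms by (auto simp: inner_kunz_form kunz_cone_def)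

text \<open>
  A proper face is disjoint from the relative interior, which is nonempty by convexity. This
  is what makes the choice of an interior point in the nilsemigroup meaningful.
\<close>

lemma face_interior_nonempty:
  fixes F :: "(real ^ 'm::nontriv mod_ring) set"
  assumes "kunz_face F"
  shows "face_interior F \<noteq> {}"
proof -
  have F: "F face_of kunz_cone" "F \<noteq> {}" using assms by (auto simp: kunz_face_def)
  then have "rel_interior F \<noteq> {}"
    using face_of_imp_convex rel_interior_eq_empty by blast
  moreover have "rel_interior F \<subseteq> face_interior F"
  proof
    fix x assume x: "x \<in> rel_interior F"
    have "x \<notin> G" if "kunz_face G" "G \<subset> F" for G
    proof -
      have "G face_of F"
        using that F face_of_imp_subset
        by (intro face_of_subset[of G kunz_cone F]) (auto simp: kunz_face_def)
      then show ?thesis using face_of_disjoint_rel_interior[of G F] that x by blast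
    qed
    then show "x \<in> face_interior F"
      using x rel_interior_subset by (auto simp: face_interior_def)
  qed
  ultimately show ?thesis by blast
qed

text \<open>
  A tight inequality cuts out a subface that contains the interior point \<open>x\<close>, hence is not
  proper: what is tight at \<open>x\<close> is tight on all of \<open>F\<close>.
\<close>

lemma face_tight:
  fixes F :: "(real ^ 'm::nontriv mod_ring) set"
  assumes F: "kunz_face F" and x: "x \<in> face_interior F" and f: "f \<in> tight_forms x" and y: "y \<in> F"
  shows "f \<bullet> y = 0"
proof -
  obtain a b where ab: "f = kunz_form a b" "a \<noteq> 0" "b \<noteq> 0" "a + b \<noteq> 0"
    "x $ a + x $ b = x $ (a + b)"
    using f by (auto simp: tight_forms_def)
  have FC: "F face_of kunz_cone" "F \<subseteq> kunz_cone"
    using F face_of_imp_subset by (auto simp: kunz_face_def)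
  let ?G = "F \<inter> {y. f \<bullet> y = 0}"
  have "?G face_of F"
    using FC ab kunz_cone_inner_ge_0 face_of_imp_convex
    by (intro face_of_Int_supporting_hyperplane_ge) blast+
  then have "?G face_of kunz_cone" using FC face_of_trans by blast
  moreover have xG: "x \<in> ?G" using x ab by (auto simp: face_interior_def inner_kunz_form)
  ultimately have "kunz_face ?G" by (auto simp: kunz_face_def)
  then have "\<not> ?G \<subset> F" using x xG unfolding face_interior_def by blast
  then show ?thesis using y by blast
qed

text \<open>
  Finitely many linear inequalities at \<open>x\<close> survive a small move in either direction along \<open>v\<close>:
  the strict ones by continuity, the tight ones because \<open>v\<close> leaves them tight.
\<close>

lemma uniform_slack:
  fixes A :: "'a::real_inner set"
  assumes "finite A" "\<And>g. g \<in> A \<Longrightarrow> g \<bullet> x \<ge> 0" "\<And>g. g \<in> A \<Longrightarrow> g \<bullet> x = 0 \<Longrightarrow> g \<bullet> v = 0"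
  shows "\<exists>\<epsilon>>0. \<forall>g\<in>A. g \<bullet> (x + \<epsilon> *\<^sub>R v) \<ge> 0 \<and> g \<bullet> (x - \<epsilon> *\<^sub>R v) \<ge> 0"
proof -
  have "\<forall>\<^sub>F \<epsilon> in at_right 0. g \<bullet> (x + \<epsilon> *\<^sub>R v) \<ge> 0 \<and> g \<bullet> (x - \<epsilon> *\<^sub>R v) \<ge> 0"
    if g: "g \<in> A" for g
  proof (cases "g \<bullet> x = 0")
    case True
    then show ?thesis using assms(3)[OF g] by (simp add: inner_add_right inner_diff_right)
  next
    case False
    then have pos: "g \<bullet> x > 0" using assms(2)[OF g] by simp
    have "((\<lambda>\<epsilon>. g \<bullet> (x + \<epsilon> *\<^sub>R v)) \<longlongrightarrow> g \<bullet> (x + 0 *\<^sub>R v)) (at_right 0)"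
      and "((\<lambda>\<epsilon>. g \<bullet> (x - \<epsilon> *\<^sub>R v)) \<longlongrightarrow> g \<bullet> (x - 0 *\<^sub>R v)) (at_right 0)"
      by (intro tendsto_intros)+
    then have "\<forall>\<^sub>F \<epsilon> in at_right 0. g \<bullet> (x + \<epsilon> *\<^sub>R v) > 0"
      and "\<forall>\<^sub>F \<epsilon> in at_right 0. g \<bullet> (x - \<epsilon> *\<^sub>R v) > 0"
      using pos by (auto dest!: order_tendstoD(1)[where a = 0])
    then show ?thesis by eventually_elim auto
  qed
  then have "\<forall>\<^sub>F \<epsilon> in at_right (0::real). \<forall>g\<in>A. g \<bullet> (x + \<epsilon> *\<^sub>R v) \<ge> 0 \<and> g \<bullet> (x - \<epsilon> *\<^sub>R v) \<ge> 0"
    using assms(1) by (simp add: eventually_ball_finite)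
  then have "\<forall>\<^sub>F \<epsilon> in at_right (0::real). 0 < \<epsilon> \<and>
      (\<forall>g\<in>A. g \<bullet> (x + \<epsilon> *\<^sub>R v) \<ge> 0 \<and> g \<bullet> (x - \<epsilon> *\<^sub>R v) \<ge> 0)"
    using eventually_at_right_less[of 0] by eventually_elim auto
  then show ?thesis
    using eventually_happens'[OF trivial_limit_at_right_real] by blast
qed

text \<open>
  A small segment around \<open>x\<close> in direction \<open>v\<close> stays inside the cone; as \<open>x\<close> is in its middle,
  the extremality property of faces puts the segment into \<open>F\<close>, so \<open>v\<close> is a multiple of a
  difference of two points of \<open>F\<close>.
\<close>

lemma tight_space_in_span:
  fixes F :: "(real ^ 'm::nontriv mod_ring) set"
  assumes F: "kunz_face F" and x: "x \<in> F" and pos: "\<And>i. i \<noteq> 0 \<Longrightarrow> x $ i > 0"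
    and v0: "v $ 0 = 0" and v: "\<And>f. f \<in> tight_forms x \<Longrightarrow> f \<bullet> v = 0"
  shows "v \<in> span F"
proof (cases "v = 0")
  case True
  then show ?thesis by (simp add: span_zero)
next
  case False
  have FC: "F face_of kunz_cone" "F \<subseteq> kunz_cone"
    using F face_of_imp_subset by (auto simp: kunz_face_def)
  \<comment> \<open>the functionals whose nonnegativity, together with \<open>x $ 0 = 0\<close>, defines the cone\<close>
  let ?A = "(\<lambda>i. axis i 1) ` (UNIV - {0}) \<union>
    (\<lambda>(a, b). kunz_form a b) ` {(a, b). a \<noteq> 0 \<and> b \<noteq> 0 \<and> a + b \<noteq> 0} :: (real ^ 'm mod_ring) set"
  have x0: "x $ 0 = 0" and xC: "x \<in> kunz_cone" using x FC by (auto simp: kunz_cone_def)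
  have "\<exists>\<epsilon>>0. \<forall>g\<in>?A. g \<bullet> (x + \<epsilon> *\<^sub>R v) \<ge> 0 \<and> g \<bullet> (x - \<epsilon> *\<^sub>R v) \<ge> 0"
  proof (rule uniform_slack)
    show "g \<bullet> x \<ge> 0" if "g \<in> ?A" for g
      using that kunz_cone_inner_ge_0[OF xC] xC by (auto simp: inner_axis' kunz_cone_def)
    show "g \<bullet> v = 0" if "g \<in> ?A" "g \<bullet> x = 0" for g
      using that(1)
    proof
      assume "g \<in> (\<lambda>i. axis i 1) ` (UNIV - {0})"
      then show ?thesis using that(2) pos by (force simp: inner_axis')
    next
      assume "g \<in> (\<lambda>(a, b). kunz_form a b) ` {(a, b). a \<noteq> 0 \<and> b \<noteq> 0 \<and> a + b \<noteq> 0}"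
      then have "g \<in> tight_forms x" using that(2)
        by (force simp: tight_forms_def inner_kunz_form)
      then show ?thesis by (rule v)
    qed
  qed simp
  then obtain \<epsilon> where \<epsilon>: "\<epsilon> > 0"
    and A: "\<And>g. g \<in> ?A \<Longrightarrow> g \<bullet> (x + \<epsilon> *\<^sub>R v) \<ge> 0 \<and> g \<bullet> (x - \<epsilon> *\<^sub>R v) \<ge> 0"
    by blast
  have C: "w \<in> kunz_cone" if "w $ 0 = 0" "\<And>g. g \<in> ?A \<Longrightarrow> g \<bullet> w \<ge> 0" for w
  proof -
    have "w $ i \<ge> 0" if "i \<noteq> 0" for i
      using \<open>\<And>g. g \<in> ?A \<Longrightarrow> g \<bullet> w \<ge> 0\<close>[of "axis i 1"] that by (simp add: inner_axis')
    moreover have "w $ i + w $ j \<ge> w $ (i + j)" if "i \<noteq> 0" "j \<noteq> 0" "i + j \<noteq> 0" for i j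
      using \<open>\<And>g. g \<in> ?A \<Longrightarrow> g \<bullet> w \<ge> 0\<close>[of "kunz_form i j"] that
      by (force simp: inner_kunz_form)
    ultimately show ?thesis using that(1) by (simp add: kunz_cone_def)
  qed
  have ends: "x + \<epsilon> *\<^sub>R v \<in> kunz_cone" "x - \<epsilon> *\<^sub>R v \<in> kunz_cone"
    using A x0 v0 by (auto intro!: C)
  have "x \<in> open_segment (x - \<epsilon> *\<^sub>R v) (x + \<epsilon> *\<^sub>R v)"
    using False \<epsilon> unfolding in_segment
    by (auto intro!: exI[of _ "1/2"] simp: algebra_simps simp flip: scaleR_add_left scaleR_2)
  then have "x + \<epsilon> *\<^sub>R v \<in> F" using FC ends x by (auto simp: face_of_def)
  then have "(1 / \<epsilon>) *\<^sub>R ((x + \<epsilon> *\<^sub>R v) - x) \<in> span F"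
    using x by (intro span_scale span_diff span_base)
  then show ?thesis using \<epsilon> by simp
qed

text \<open>
  The span of \<open>F\<close> is the orthogonal complement of the tight forms and of the form \<open>y $ 0\<close>, which
  accounts for the surplus coordinate of the ambient space. The rank of this system thus
  is the codimension of \<open>F\<close>, and from here on only this rank is estimated.
\<close>

lemma dim_face:
  fixes F :: "(real ^ 'm::nontriv mod_ring) set"
  assumes F: "kunz_face F" and x: "x \<in> face_interior F" and pos: "\<And>i. i \<noteq> 0 \<Longrightarrow> x $ i > 0"
  shows "dim F + dim (insert (axis 0 1) (tight_forms x)) = CARD('m)"
proof -
  let ?R = "insert (axis 0 1) (tight_forms x)"
  let ?V = "{y \<in> UNIV. \<forall>f \<in> span ?R. orthogonal f y}"
  have FC: "F \<subseteq> kunz_cone" using F face_of_imp_subset by (auto simp: kunz_face_def)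
  have xF: "x \<in> F" using x by (simp add: face_interior_def)
  have "F \<subseteq> ?V"
  proof
    fix y assume y: "y \<in> F"
    have "orthogonal y f" if "f \<in> span ?R" for f
    proof (rule orthogonal_to_span[OF that])
      fix g assume "g \<in> ?R"
      then show "orthogonal y g"
        using face_tight[OF F x _ y] FC y
        by (auto simp: orthogonal_def inner_commute[of y] kunz_cone_def inner_axis')
    qed
    then show "y \<in> ?V" by (simp add: orthogonal_commute)
  qed
  moreover have "?V \<subseteq> span F"
  proof
    fix v assume "v \<in> ?V"
    then have v: "\<And>f. f \<in> ?R \<Longrightarrow> f \<bullet> v = 0"
      by (auto simp: orthogonal_def span_base)
    show "v \<in> span F"
      by (rule tight_space_in_span[OF F xF pos])
        (use v[of "axis 0 1"] v in \<open>auto simp: inner_axis'\<close>)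
  qed
  ultimately have "dim F = dim ?V"
    using dim_subset[of F ?V] dim_subset[of ?V "span F"] by (simp only: dim_span order_antisym)
  moreover have "dim ?V + dim (span ?R) = dim (UNIV :: (real ^ 'm mod_ring) set)"
    by (rule dim_subspace_orthogonal_to_vectors) auto
  ultimately show ?thesis by (simp only: dim_span) simp
qed

section \<open>Atoms and the upper bound on the dimension\<close>

definition nonatoms :: "real ^ 'm::nontriv mod_ring \<Rightarrow> 'm mod_ring set" where
  "nonatoms x = {a + b | a b. a \<noteq> 0 \<and> b \<noteq> 0 \<and> a + b \<noteq> 0 \<and> x $ a + x $ b = x $ (a + b)}"

lemma zero_notin_nonatoms [simp]: "0 \<notin> nonatoms x"
  by (auto simp: nonatoms_def)

lemma card_Compl_nonatoms:
  fixes x :: "real ^ 'm::nontriv mod_ring"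
  shows "card (- insert 0 (nonatoms x)) + card (nonatoms x) + 1 = CARD('m)"
proof -
  let ?A = "insert 0 (nonatoms x)"
  have "card (- ?A \<union> ?A) = card (- ?A) + card ?A" by (rule card_Un_disjoint) auto
  moreover have "- ?A \<union> ?A = UNIV" by blast
  ultimately have "CARD('m) = card (- ?A) + card ?A" by (metis CARD_mod_ring)
  then show ?thesis by simp
qed

text \<open>
  Neither \<open>0\<close> (the identity) nor \<open>\<infinity> = \<infinity> \<oplus> \<infinity>\<close> is an atom. These two and the residues in
  \<open>nonatoms x\<close> are the elements of the nilsemigroup that the embedding dimension misses.
\<close>

lemma embdim_conv_nonatoms:
  fixes F :: "(real ^ 'm::nontriv mod_ring) set"
  assumes "x = (SOME x. x \<in> face_interior F)"
  shows "embdim F + card (nonatoms x) + 1 = CARD('m)"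
proof -
  let ?N = "kunz_nilsemigroup F"
  have N: "carrier ?N = UNIV" "mult ?N = nil_add x" "one ?N = Some 0"
    using assms by (simp_all add: kunz_nilsemigroup_def)
  have "None = nil_add x None None" by simp
  then have 1: "None \<notin> atoms ?N" unfolding atoms_def N by blast
  have 2: "Some c \<in> atoms ?N \<longleftrightarrow> c \<notin> insert 0 (nonatoms x)" for c
  proof -
    have "(\<exists>b \<in> UNIV - {Some 0}. \<exists>d \<in> UNIV - {Some 0}. Some c = nil_add x b d) \<longleftrightarrow>
        (\<exists>a b. a \<noteq> 0 \<and> b \<noteq> 0 \<and> c = a + b \<and> x $ a + x $ b = x $ (a + b))" (is "?L = ?R")
    proof
      assume ?L
      then obtain b d where bd: "b \<noteq> Some 0" "d \<noteq> Some 0" "Some c = nil_add x b d" by blast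
      then show ?R by (cases b; cases d) (auto split: if_splits)
    next
      assume ?R
      then obtain a b where "a \<noteq> 0" "b \<noteq> 0" "c = a + b" "x $ a + x $ b = x $ (a + b)" by blast
      then show ?L by (intro bexI[of _ "Some a"] bexI[of _ "Some b"]) auto
    qed
    then show ?thesis unfolding atoms_def N by (auto simp: nonatoms_def)
  qed
  have "atoms ?N = Some ` (- insert 0 (nonatoms x))"
  proof (rule Set.set_eqI)
    fix z show "z \<in> atoms ?N \<longleftrightarrow> z \<in> Some ` (- insert 0 (nonatoms x))"
      using 1 2 by (cases z) auto
  qed
  then have "embdim F = card (- insert 0 (nonatoms x))"
    by (simp add: embdim_def card_image)
  then show ?thesis using card_Compl_nonatoms[of x] by simp
qed

text \<open>
  The tight forms and the coordinate functionals of the atoms together span everything, since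
  \<open>axis (a + b) 1 = axis a 1 + axis b 1 - kunz_form a b\<close> reduces a non-atom to residues with
  smaller \<open>x\<close>-value. With \<open>dim_face\<close> and \<open>embdim_conv_nonatoms\<close> this says \<open>d \<le> e\<close>.
\<close>

lemma dim_tight_forms_ge:
  fixes x :: "real ^ 'm::nontriv mod_ring"
  assumes pos: "\<And>i. i \<noteq> 0 \<Longrightarrow> x $ i > 0"
  shows "card (nonatoms x) + 1 \<le> dim (insert (axis 0 1) (tight_forms x))"
proof -
  let ?R = "insert (axis 0 1) (tight_forms x)"
  let ?B = "(\<lambda>i. axis i (1::real)) ` (- insert 0 (nonatoms x))"
  have "axis c 1 \<in> span (?R \<union> ?B)" for c
  proof (induction "card {i. x $ i < x $ c}" arbitrary: c rule: less_induct)
    case less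
    show ?case
    proof (cases "c \<in> nonatoms x")
      case True
      then obtain a b where ab: "c = a + b" "a \<noteq> 0" "b \<noteq> 0" "a + b \<noteq> 0"
          "x $ a + x $ b = x $ (a + b)"
        by (auto simp: nonatoms_def)
      then have lt: "x $ a < x $ c" "x $ b < x $ c" using pos[of a] pos[of b] by auto
      have "axis a 1 \<in> span (?R \<union> ?B)" "axis b 1 \<in> span (?R \<union> ?B)"
        using lt by (intro less psubset_card_mono; force)+
      moreover have "kunz_form a b \<in> span (?R \<union> ?B)"
        using ab by (intro span_base) (auto simp: tight_forms_def)
      ultimately have "axis a 1 + axis b 1 - kunz_form a b \<in> span (?R \<union> ?B)"
        by (intro span_add span_diff)
      then show ?thesis using ab by (simp add: kunz_form_def)
    next
      case False
      then show ?thesis by (cases "c = 0") (auto intro!: span_base)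
    qed
  qed
  then have "Basis \<subseteq> span (?R \<union> ?B)" by (auto simp: Basis_vec_def)
  then have "span Basis \<subseteq> span (?R \<union> ?B)" by (rule span_minimal) (rule subspace_span)
  then have "span (?R \<union> ?B) = UNIV"
    by (simp only: span_Basis top_unique)
  then have "CARD('m) = dim (?R \<union> ?B)"
    by (metis CARD_mod_ring DIM_cart DIM_real dim_UNIV dim_span mult.right_neutral)
  also have "\<dots> \<le> dim ?R + dim ?B"
  proof -
    have "dim (span (?R \<union> ?B)) \<le> dim (span ?R) + dim (span ?B)"
      unfolding span_Un
      using dim_sums_Int[of "span ?R" "span ?B", OF subspace_span subspace_span] by linarith
    then show ?thesis by (simp only: dim_span)
  qed
  also have "dim ?B \<le> card (- insert 0 (nonatoms x))"
    using dim_le_card'[of ?B] card_image_le[of "- insert 0 (nonatoms x)" "\<lambda>i. axis i (1::real)"]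
    by (simp add: le_trans)
  finally have "CARD('m) \<le> dim ?R + card (- insert 0 (nonatoms x))" by simp
  then show ?thesis using card_Compl_nonatoms[of x] by simp
qed

section \<open>Counting decompositions of a residue\<close>

definition decomposition_forms :: "'m::nontriv mod_ring \<Rightarrow> (real ^ 'm mod_ring) set" where
  "decomposition_forms c = {kunz_form a (c - a) | a. a \<noteq> 0 \<and> a \<noteq> c}"

lemma mod_ring_of_nat_cases:
  fixes a :: "'m::nontriv mod_ring"
  obtains k where "k < CARD('m)" "a = of_nat k"
proof -
  have "to_int_mod_ring a \<in> {0..<int CARD('m)}"
    using range_to_int_mod_ring by blast
  then have "nat (to_int_mod_ring a) < CARD('m)" "a = of_nat (nat (to_int_mod_ring a))"
    by (auto simp: of_nat_of_int_mod_ring)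
  then show ?thesis using that by blast
qed

text \<open>
  Represent \<open>c\<close> by \<open>n < m\<close> and the summands by \<open>k, l < m\<close>. Then \<open>k + l\<close> is \<open>n\<close> or \<open>n + m\<close>, and up
  to order the smaller summand lies in \<open>{1..n div 2}\<close> or in \<open>{n + 1..(n + m) div 2}\<close>
  respectively: that is \<open>\<lfloor>n/2\<rfloor> + \<lfloor>(m - n)/2\<rfloor> \<le> \<lfloor>m/2\<rfloor>\<close> choices.
\<close>

lemma card_decomposition_forms:
  fixes c :: "'m::nontriv mod_ring"
  shows "card (decomposition_forms c) \<le> CARD('m) div 2"
proof -
  obtain n where n: "n < CARD('m)" "c = of_nat n" by (rule mod_ring_of_nat_cases)
  let ?f = "\<lambda>k. kunz_form (of_nat k) (c - of_nat k)"
  let ?K = "{1..n div 2} \<union> {n + 1..(n + CARD('m)) div 2}"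
  have "decomposition_forms c \<subseteq> ?f ` ?K"
  proof
    fix f assume "f \<in> decomposition_forms c"
    then obtain a where a: "f = kunz_form a (c - a)" "a \<noteq> 0" "a \<noteq> c" by (auto simp: decomposition_forms_def)
    obtain k where k: "k < CARD('m)" "a = of_nat k" by (rule mod_ring_of_nat_cases)
    have "k \<noteq> 0" "k \<noteq> n" using a k n by (metis of_nat_0)+
    have sym: "?f l = f" if "of_nat l = c - a" for l
      using that a by (simp add: kunz_form_commute)
    consider "k < n" "k \<in> ?K" | "k < n" "n - k \<in> ?K" | "k > n" "k \<in> ?K"
      | "k > n" "n + CARD('m) - k \<in> ?K"
      using \<open>k \<noteq> 0\<close> \<open>k \<noteq> n\<close> k(1) by fastforce
    then show "f \<in> ?f ` ?K"
    proof cases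
      case 2
      have "of_nat (n - k) = c - a" using 2(1) k n by simp
      then have "f = ?f (n - k)" using sym by simp
      then show ?thesis using 2(2) by (rule image_eqI)
    next
      case 4
      have "of_nat (n + CARD('m) - k) = c - a" using k n by simp
      then have "f = ?f (n + CARD('m) - k)" using sym by simp
      then show ?thesis using 4(2) by (rule image_eqI)
    next
      case 1
      then show ?thesis using a(1) k(2) by (intro image_eqI[of _ _ k]) simp_all
    next
      case 3
      then show ?thesis using a(1) k(2) by (intro image_eqI[of _ _ k]) simp_all
    qed
  qed
  then have "card (decomposition_forms c) \<le> card ?K"
    by (meson card_image_le card_mono finite_Un finite_atLeastAtMost finite_imageI le_trans)
  also have "\<dots> \<le> n div 2 + ((n + CARD('m)) div 2 - n)"
    using card_Un_le[of "{1..n div 2}" "{n + 1..(n + CARD('m)) div 2}"] by simp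
  also have "\<dots> \<le> CARD('m) div 2"
    using n(1) by linarith
  finally show ?thesis .
qed

lemma finite_decomposition_forms [simp]: "finite (decomposition_forms c)"
  by (rule finite_subset[of _ "range (\<lambda>a. kunz_form a (c - a))"]) (auto simp: decomposition_forms_def)

lemma tight_forms_subset: "tight_forms x \<subseteq> (\<Union>c \<in> nonatoms x. decomposition_forms c)"
proof
  fix f assume "f \<in> tight_forms x"
  then obtain a b where ab: "f = kunz_form a b" "a \<noteq> 0" "b \<noteq> 0" "a + b \<noteq> 0"
      "x $ a + x $ b = x $ (a + b)"
    by (auto simp: tight_forms_def)
  then have "f = kunz_form a ((a + b) - a)" "a \<noteq> a + b" "a + b \<in> nonatoms x"
    by (auto simp: nonatoms_def)
  then show "f \<in> (\<Union>c \<in> nonatoms x. decomposition_forms c)"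
    using ab(2) unfolding decomposition_forms_def by blast
qed

lemma dim_insert_tight_forms_le:
  assumes "tight_forms x \<subseteq> S" "finite S"
  shows "dim (insert (axis 0 1) (tight_forms x)) \<le> card S + 1"
proof -
  have "dim (insert (axis 0 1) (tight_forms x)) \<le> dim (insert (axis 0 1) S)"
    using assms by (intro dim_subset) auto
  also have "\<dots> \<le> card (insert (axis 0 1) S)" using assms by (intro dim_le_card') auto
  also have "\<dots> \<le> card S + 1" using assms by (simp add: card_insert_if)
  finally show ?thesis .
qed

section \<open>Two decomposable residues\<close>

text \<open>
  The combinatorial heart of part (c). Reflecting a residue \<open>a\<close> first by \<open>a \<mapsto> p - a\<close> and then by
  \<open>a \<mapsto> q - a\<close> translates it by \<open>t = q - p\<close>. If all decompositions of \<open>p\<close> and \<open>q\<close> other than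
  \<open>p = q + (p - q)\<close> were tight, each such translation would itself be a tight relation
  \<open>x\<^sub>a + x\<^sub>t = x\<^bsub>a+t\<^esub>\<close>, so that \<open>a + t\<close> would be \<open>p\<close> or \<open>q\<close>. Only five residues escape
  this conclusion.
\<close>

lemma not_all_tight:
  fixes x :: "real ^ 'm::nontriv mod_ring"
  assumes m: "CARD('m) \<ge> 6" and N: "nonatoms x = {p, q}" and "p \<noteq> q"
    and P: "\<And>a. a \<notin> {0, p, q, p - q} \<Longrightarrow> x $ a + x $ (p - a) = x $ p"
    and Q: "\<And>a. a \<notin> {0, q} \<Longrightarrow> x $ a + x $ (q - a) = x $ q"
  shows False
proof -
  have p0: "p \<noteq> 0" using N zero_notin_nonatoms[of x] by auto
  define t where "t = q - p"
  have t: "x $ t = x $ q - x $ p" using Q[of p] p0 \<open>p \<noteq> q\<close> by (simp add: t_def)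
  have "a \<in> {0, p, q, p - q, p - t}" for a
  proof (rule ccontr)
    assume a: "a \<notin> {0, p, q, p - q, p - t}"
    have "x $ a + x $ (p - a) = x $ p" using P a by simp
    moreover have "x $ (p - a) + x $ (q - (p - a)) = x $ q"
      using Q[of "p - a"] a by (auto simp: algebra_simps)
    moreover have "q - (p - a) = a + t" by (simp add: t_def)
    ultimately have "x $ a + x $ t = x $ (a + t)" using t by simp
    moreover have "a \<noteq> 0" "t \<noteq> 0" "a + t \<noteq> 0"
      using a \<open>p \<noteq> q\<close> by (auto simp: t_def algebra_simps)
    ultimately have "a + t \<in> nonatoms x" by (auto simp: nonatoms_def)
    then show False using N a by (auto simp: t_def algebra_simps)
  qed
  then have "(UNIV :: 'm mod_ring set) = {0, p, q, p - q, p - t}" by blast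
  then have "CARD('m mod_ring) = card {0, p, q, p - q, p - t}" by metis
  also have "\<dots> \<le> 5" using card_length[of "[0, p, q, p - q, p - t]"] by simp
  finally show False using m by simp
qed

text \<open>
  For \<open>m = 2k + 1\<close> the available relations number at most \<open>(k - 1) + k\<close>, where one is lost for
  \<open>p\<close> because \<open>p = q + (p - q)\<close> would force \<open>x\<^sub>q < x\<^sub>p\<close>. By \<open>not_all_tight\<close> at least one more
  fails, and the form \<open>y $ 0\<close> adds one to the rank.
\<close>

lemma two_nonatoms_codim_ge_2:
  fixes x :: "real ^ 'm::nontriv mod_ring"
  assumes m: "CARD('m) \<ge> 6" "odd CARD('m)" and pos: "\<And>i. i \<noteq> 0 \<Longrightarrow> x $ i > 0"
    and N: "nonatoms x = {p, q}" and "p \<noteq> q" and le: "x $ p \<le> x $ q"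
  shows "dim (insert (axis 0 1) (tight_forms x)) + 2 \<le> CARD('m)"
proof -
  have q0: "q \<noteq> 0" using N zero_notin_nonatoms[of x] by auto
  let ?g = "kunz_form q (p - q)"
  let ?S = "(decomposition_forms p - {?g}) \<union> decomposition_forms q"
  \<comment> \<open>the coordinate at \<open>q\<close> distinguishes this form from those of the other decompositions of \<open>p\<close>\<close>
  have g_eq: "a = q \<or> a = p - q" if "kunz_form a (p - a) = ?g" for a
  proof (rule ccontr)
    assume "\<not> ?thesis"
    then have "a \<noteq> q" "p - a \<noteq> q" by auto
    moreover have "kunz_form a (p - a) $ q = ?g $ q" using that by simp
    ultimately show False using \<open>p \<noteq> q\<close>
      by (auto simp: kunz_form_def axis_def split: if_splits)
  qed
  have tight0: "f \<bullet> x = 0" if "f \<in> tight_forms x" for f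
    using that by (auto simp: tight_forms_def inner_kunz_form)
  have "?g \<notin> tight_forms x"
    using tight0[of ?g] pos[of "p - q"] \<open>p \<noteq> q\<close> le by (auto simp: inner_kunz_form)
  then have sub: "tight_forms x \<subseteq> ?S" using tight_forms_subset[of x] N by auto
  have "\<exists>f \<in> ?S. f \<notin> tight_forms x"
  proof (rule ccontr)
    assume "\<not> ?thesis"
    then have all: "f \<bullet> x = 0" if "f \<in> ?S" for f using that tight0 by blast
    have "x $ a + x $ (p - a) = x $ p" if "a \<notin> {0, p, q, p - q}" for a
      using all[of "kunz_form a (p - a)"] g_eq[of a] that
      by (auto simp: decomposition_forms_def inner_kunz_form)
    moreover have "x $ a + x $ (q - a) = x $ q" if "a \<notin> {0, q}" for a
      using all[of "kunz_form a (q - a)"] that by (auto simp: decomposition_forms_def inner_kunz_form)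
    ultimately show False using not_all_tight[OF m(1) N \<open>p \<noteq> q\<close>] by blast
  qed
  then have "card (tight_forms x) < card ?S"
    using sub by (intro psubset_card_mono) auto
  also have "card ?S \<le> card (decomposition_forms p - {?g}) + card (decomposition_forms q)" by (rule card_Un_le)
  also have "card (decomposition_forms p - {?g}) = card (decomposition_forms p) - 1"
    using q0 \<open>p \<noteq> q\<close> by (intro card_Diff_singleton) (auto simp: decomposition_forms_def)
  finally have "card (tight_forms x) < (CARD('m) div 2 - 1) + CARD('m) div 2"
    using card_decomposition_forms[of p] card_decomposition_forms[of q] by linarith
  moreover have "dim (insert (axis 0 1) (tight_forms x)) \<le> card (tight_forms x) + 1"
    using sub by (intro dim_insert_tight_forms_le) (auto intro: finite_subset)
  moreover obtain k where "CARD('m) = 2 * k + 1" using m(2) by (rule oddE)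
  ultimately show ?thesis by simp
qed

theorem theorem4p4:
  fixes F :: "(real ^ ('m::nontriv) mod_ring) set"
    and m e d :: nat
  assumes "m = CARD('m)" and "m \<ge> 7"
    and "kunz_face F" and "\<not> degenerate F"
    and "e = embdim F" and "d = dim F"
  shows "(e = m - 1 \<longrightarrow> d = m - 1) \<and>
    (e = m - 2 \<longrightarrow> \<lfloor>(real m - 1) / 2\<rfloor> \<le> int d \<and> d \<le> e) \<and>
    (e = m - 3 \<and> odd m \<longrightarrow> 2 \<le> d \<and> d \<le> e)"
proof -
  define x where "x = (SOME x. x \<in> face_interior F)"
  have xF: "x \<in> face_interior F"
    unfolding x_def using face_interior_nonempty[OF assms(3)] by (simp add: some_in_eq)
  have "x \<in> kunz_cone"
    using xF assms(3) face_of_imp_subset by (auto simp: face_interior_def kunz_face_def)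
  then have pos: "x $ i > 0" if "i \<noteq> 0" for i
    using that xF assms(4) by (force simp: degenerate_def kunz_cone_def order.strict_iff_order)
  let ?r = "dim (insert (axis 0 1) (tight_forms x))"
  have e: "e + card (nonatoms x) + 1 = m"
    using embdim_conv_nonatoms[OF x_def] assms by simp
  have d: "d + ?r = m" using dim_face[OF assms(3) xF pos] assms by simp
  have "card (nonatoms x) + 1 \<le> ?r" using pos by (rule dim_tight_forms_ge)
  then have de: "d \<le> e" using e d by linarith
  have a: "d = m - 1" if "e = m - 1"
  proof -
    have "nonatoms x = {}" using that e assms(2) by simp
    then have "?r \<le> 1"
      using dim_insert_tight_forms_le[of x "{}"] tight_forms_subset[of x] by simp
    then show ?thesis using d de that by linarith
  qed
  have b: "\<lfloor>(real m - 1) / 2\<rfloor> \<le> int d" if "e = m - 2"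
  proof -
    have "card (nonatoms x) = 1" using that e assms(2) by simp
    then obtain c where "nonatoms x = {c}" by (rule card_1_singletonE)
    then have "?r \<le> card (decomposition_forms c) + 1"
      using tight_forms_subset[of x] by (intro dim_insert_tight_forms_le) auto
    then have "m \<le> d + m div 2 + 1" using d card_decomposition_forms[of c] assms(1) by linarith
    then have "m \<le> 2 * d + 2" by linarith
    then have "(real m - 1) / 2 < real_of_int (int d + 1)" by simp
    then show ?thesis by linarith
  qed
  have c: "2 \<le> d" if "e = m - 3" "odd m"
  proof -
    have "card (nonatoms x) = 2" using that e assms(2) by simp
    then obtain p q where "nonatoms x = {p, q}" "p \<noteq> q" by (auto simp: card_2_iff)
    then obtain p q where "nonatoms x = {p, q}" "p \<noteq> q" "x $ p \<le> x $ q"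
      by (metis insert_commute linear)
    then have "?r + 2 \<le> m"
      using two_nonatoms_codim_ge_2[of x p q] pos assms(1,2) that by simp
    then show ?thesis using d by linarith
  qed
  show ?thesis using a b c de by blast
qed

end
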